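(* Let $f:\mathbb{R}^n\to\mathbb{R}$ be smooth, strongly convex with parameters $L\ge\ell>0$ and minimizer $x^*$, and let $\kappa=L/\ell$. Let $x_k,w_k$ be generated by the Accelerated Gradient (AG) algorithm applied to $f$ from an arbitrary $x_0\in\mathbb{R}^n$, and let $y_k,\tilde\sigma_k$ be the auxiliary sequences defined in the context. Then for each $k=0,1,2,\ldots$, $$\|y_k-x^*\|^2+\frac{2(f(x_k)-f(x^* ))}{\ell}\le\tilde\sigma_k^2 .$$
   Context: A differentiable convex function $f:\mathbb{R}^n\to\mathbb{R}$ is smooth, strongly convex with parameters $L\ge\ell>0$ if for all $x,y\in\mathbb{R}^n$, $\ \ell\|x-y\|^2/2\le f(y)-f(x)-\nabla f(x)^T(y-x)\le L\|x-y\|^2/2$. Such $f$ has a unique minimizer $x^*$. Accelerated Gradient (AG): $x_0$ is arbitrary, $w_0:=x_0$; for $k=1,2,\ldots$: $x_k:=w_{k-1}-\nabla f(w_{k-1})/L$ and $w_k:=x_k+\theta(x_k-x_{k-1})$, where $\theta=\dfrac{\sqrt\kappa-1}{\sqrt\kappa+1}$. Auxiliary sequences: $y_0=x_0$ and $y_k=x_k+\tau(x_k-x_{k-1})$ for $k=1,2,\ldots$, where $\tau=\sqrt\kappa-1$; $\tilde\sigma_0=\sqrt2\,\|\nabla f(x_0)\|/\ell$ and, for $k=0,1,2,\ldots$, $$\tilde\sigma_{k+1}=\left[(1-\kappa^{-1/2})\tilde\sigma_k^2+\frac{2(f(x_{k+1})-f(w_k))}{\ell}+\frac{\|\nabla f(w_k)\|^2}{L\ell}-(\kappa^{1/2}-\kappa^{-1/2})\|w_k-x_k\|^2\right]^{1/2}.$$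 *)

theory Defs
  imports "HOL-Analysis.Analysis"
begin

definition grad :: "('a::real_inner \<Rightarrow> real) \<Rightarrow> 'a \<Rightarrow> 'a" where
  "grad f x = (THE D. GDERIV f x :> D)"

definition smooth_strongly_convex ::
    "('a::real_inner \<Rightarrow> real) \<Rightarrow> real \<Rightarrow> real \<Rightarrow> bool" where
  "smooth_strongly_convex f L l \<longleftrightarrow>
     (\<forall>x. f differentiable (at x)) \<and> convex_on UNIV f \<and> L \<ge> l \<and> l > 0 \<and>
     (\<forall>x y. l * (norm (x - y))\<^sup>2 / 2 \<le> f y - f x - grad f x \<bullet> (y - x) \<and>
            f y - f x - grad f x \<bullet> (y - x) \<le> L * (norm (x - y))\<^sup>2 / 2)"

definition ag_theta :: "real \<Rightarrow> real" where
  "ag_theta \<kappa> = (sqrt \<kappa> - 1) / (sqrt \<kappa> + 1)"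

definition ag_tau :: "real \<Rightarrow> real" where
  "ag_tau \<kappa> = sqrt \<kappa> - 1"

definition accelerated_gradient ::
    "('a::real_inner \<Rightarrow> real) \<Rightarrow> real \<Rightarrow> real \<Rightarrow> 'a \<Rightarrow> (nat \<Rightarrow> 'a) \<Rightarrow> (nat \<Rightarrow> 'a) \<Rightarrow> bool" where
  "accelerated_gradient f L l x0 x w \<longleftrightarrow>
     x 0 = x0 \<and> w 0 = x0 \<and>
     (\<forall>k. x (Suc k) = w k - grad f (w k) /\<^sub>R L \<and>
          w (Suc k) = x (Suc k) + ag_theta (L / l) *\<^sub>R (x (Suc k) - x k))"

primrec ag_y :: "real \<Rightarrow> (nat \<Rightarrow> 'a::real_inner) \<Rightarrow> nat \<Rightarrow> 'a" where
  "ag_y \<kappa> x 0 = x 0"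
| "ag_y \<kappa> x (Suc k) = x (Suc k) + ag_tau \<kappa> *\<^sub>R (x (Suc k) - x k)"

text \<open>
  The expression under the square root in the recursion for sigma, with \<open>s\<close> standing for
  the current value of sigma.
\<close>
definition sigma_radicand ::
    "('a::real_inner \<Rightarrow> real) \<Rightarrow> real \<Rightarrow> real \<Rightarrow> (nat \<Rightarrow> 'a) \<Rightarrow> (nat \<Rightarrow> 'a) \<Rightarrow> nat \<Rightarrow> real \<Rightarrow> real" where
  "sigma_radicand f L l x w k s =
     (let \<kappa> = L / l in
        (1 - 1 / sqrt \<kappa>) * s\<^sup>2
        + 2 * (f (x (Suc k)) - f (w k)) / l
        + (norm (grad f (w k)))\<^sup>2 / (L * l)
        - (sqrt \<kappa> - 1 / sqrt \<kappa>) * (norm (w k - x k))\<^sup>2)"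

text \<open>
  Pitfall: \<^const>\<open>sqrt\<close> is an odd total function on the reals, so on a negative radicand the
  square of sigma is the absolute value of the radicand. Hence a claim about sigma carries its
  usual meaning only together with nonnegativity of \<^const>\<open>sigma_radicand\<close>.
\<close>
primrec ag_sigma ::
    "('a::real_inner \<Rightarrow> real) \<Rightarrow> real \<Rightarrow> real \<Rightarrow> (nat \<Rightarrow> 'a) \<Rightarrow> (nat \<Rightarrow> 'a) \<Rightarrow> nat \<Rightarrow> real" where
  "ag_sigma f L l x w 0 = sqrt 2 * norm (grad f (x 0)) / l"
| "ag_sigma f L l x w (Suc k) = sqrt (sigma_radicand f L l x w k (ag_sigma f L l x w k))"

end

theory Submission
  imports Defs
begin

text \<open>
  Put \<open>s = sqrt (L / l)\<close>, \<open>z = w\<^sub>k - xstar\<close>, \<open>u = w\<^sub>k - x\<^sub>k\<close> and \<open>g = grad f (w\<^sub>k)\<close>. Then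
  \<open>y\<^sub>k - xstar = z + s u\<close> and \<open>y\<^sub>k\<^sub>+\<^sub>1 - xstar = z + (s - 1) u - (s / L) g\<close>. Add the strong convexity
  inequalities at base point \<open>w\<^sub>k\<close>, towards \<open>xstar\<close> with weight \<open>1 / s\<close> and towards \<open>x\<^sub>k\<close> with
  weight \<open>1 - 1 / s\<close>. All quadratic terms cancel, so the potential
  \<open>\<parallel>y\<^sub>k - xstar\<parallel>\<^sup>2 + 2 (f x\<^sub>k - f xstar) / l\<close> satisfies the recursion of \<open>\<sigma>\<^sub>k\<^sup>2\<close> as an inequality.
\<close>

lemma strong_convexity_ineq:
  assumes "smooth_strongly_convex f L l"
  shows "f a - f b \<le> grad f a \<bullet> (a - b) - l * ((a - b) \<bullet> (a - b)) / 2"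
proof -
  have "l * (norm (a - b))\<^sup>2 / 2 \<le> f b - f a - grad f a \<bullet> (b - a)"
    using assms by (simp add: smooth_strongly_convex_def)
  then show ?thesis
    by (simp add: power2_norm_eq_inner inner_diff_right)
qed

text \<open>The smoothness upper bound shows that a gradient step of length \<open>1 / L\<close>
  from \<open>m\<close> lowers \<open>f\<close> by at least
  \<open>(norm (grad f m))^2 / (2 * L)\<close>, which minimality permits only for a zero
  gradient.\<close>

lemma grad_eq_0_at_minimizer:
  assumes f: "smooth_strongly_convex f L l" and "is_arg_min f (\<lambda>_. True) m"
  shows "grad f m = 0"
proof -
  let ?g = "grad f m"
  have L: "L > 0"
    using f by (simp add: smooth_strongly_convex_def)
  have "f m \<le> f (m - ?g /\<^sub>R L)"
    using assms(2) by (simp add: is_arg_min_linorder)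
  moreover have "f (m - ?g /\<^sub>R L) - f m - ?g \<bullet> (m - ?g /\<^sub>R L - m)
      \<le> L * (norm (m - (m - ?g /\<^sub>R L)))\<^sup>2 / 2"
    using f unfolding smooth_strongly_convex_def by blast
  moreover have "L * (norm (m - (m - ?g /\<^sub>R L)))\<^sup>2 / 2 = ?g \<bullet> ?g / L / 2"
    using L by (simp add: power2_norm_eq_inner field_simps power2_eq_square[of L])
  moreover have "?g \<bullet> (m - ?g /\<^sub>R L - m) = - (?g \<bullet> ?g / L)"
    by (simp add: divide_inverse)
  ultimately have "?g \<bullet> ?g / L \<le> ?g \<bullet> ?g / L / 2"
    by linarith
  then have "?g \<bullet> ?g \<le> 0"
    using L by (simp add: field_simps)
  then show ?thesis
    by (metis inner_gt_zero_iff not_le)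
qed

text \<open>Write \<open>d\<close> for the distance from \<open>a\<close> to \<open>m\<close> and
  \<open>G\<close> for the gradient norm at \<open>a\<close>. Strong convexity based at
  \<open>a\<close> and at \<open>m\<close> (where the gradient vanishes) adds up to
  \<open>l * d^2 \<le> G * d\<close>, hence \<open>l * d \<le> G\<close>. The inequality based at
  \<open>a\<close> alone bounds the potential by \<open>2 * G * d / l\<close>, and substituting the
  bound on \<open>d\<close> yields the square of the initial sigma.\<close>

lemma initial_potential_le:
  assumes f: "smooth_strongly_convex f L l" and m: "is_arg_min f (\<lambda>_. True) m"
  shows "(norm (a - m))\<^sup>2 + 2 * (f a - f m) / l \<le> (sqrt 2 * norm (grad f a) / l)\<^sup>2"
proof -
  let ?d = "norm (a - m)" and ?G = "norm (grad f a)"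
  have l: "l > 0"
    using f by (simp add: smooth_strongly_convex_def)
  have upper: "f a - f m \<le> grad f a \<bullet> (a - m) - l * ?d\<^sup>2 / 2"
    using strong_convexity_ineq[OF f, of a m] by (simp add: power2_norm_eq_inner)
  have lower: "l * ?d\<^sup>2 / 2 \<le> f a - f m"
    using strong_convexity_ineq[OF f, of m a] grad_eq_0_at_minimizer[OF f m]
    by (simp add: power2_norm_eq_inner[symmetric] norm_minus_commute)
  have cs: "grad f a \<bullet> (a - m) \<le> ?G * ?d"
    by (rule norm_cauchy_schwarz)
  have "(l * ?d) * ?d \<le> ?G * ?d"
    using upper lower cs by (simp add: power2_eq_square)
  then have d: "l * ?d \<le> ?G"
    by (cases "?d = 0") (auto simp: mult_le_cancel_right)
  have "l * (l * ?d\<^sup>2 + 2 * (f a - f m)) \<le> l * (2 * (?G * ?d))"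
    using upper cs l by (intro mult_left_mono) auto
  also have "\<dots> = 2 * ?G * (l * ?d)"
    by simp
  also have "\<dots> \<le> 2 * ?G * ?G"
    using d by (intro mult_left_mono) auto
  finally have "l * (l * ?d\<^sup>2 + 2 * (f a - f m)) / l\<^sup>2 \<le> 2 * ?G * ?G / l\<^sup>2"
    by (rule divide_right_mono) simp
  moreover have "l * (l * ?d\<^sup>2 + 2 * (f a - f m)) / l\<^sup>2 = ?d\<^sup>2 + 2 * (f a - f m) / l"
    using l by (simp add: field_simps power2_eq_square)
  moreover have "2 * ?G * ?G / l\<^sup>2 = (sqrt 2 * ?G / l)\<^sup>2"
    by (simp add: power_divide power_mult_distrib power2_eq_square[of ?G])
  ultimately show ?thesis
    by simp
qed

lemma potential_step:
  fixes u z g :: "'a::real_inner"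
  assumes s: "s \<ge> 1" and l: "l > 0" and L: "L = s\<^sup>2 * l"
    and min: "fw - fm \<le> g \<bullet> z - l * (z \<bullet> z) / 2"
    and cur: "fw - fx \<le> g \<bullet> u - l * (u \<bullet> u) / 2"
  shows "(norm (z + (s - 1) *\<^sub>R u - (s / L) *\<^sub>R g))\<^sup>2 + 2 * (fx' - fm) / l
    \<le> (1 - 1 / s) * ((norm (z + s *\<^sub>R u))\<^sup>2 + 2 * (fx - fm) / l)
      + 2 * (fx' - fw) / l + (norm g)\<^sup>2 / (L * l) - (s - 1 / s) * (norm u)\<^sup>2"
    (is "?A \<le> ?B")
proof -
  \<comment> \<open>The gap is exactly the weighted sum of the slacks in \<open>min\<close> and
    \<open>cur\<close>: \<open>fx'\<close> cancels, and \<open>L = s^2 * l\<close> gives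
    \<open>(s / L)^2 = 1 / (L * l)\<close>, which removes the square of \<open>g\<close>.\<close>
  have "?B - ?A = 2 / l * ((1 / s) * (g \<bullet> z - l * (z \<bullet> z) / 2 - (fw - fm))
      + (1 - 1 / s) * (g \<bullet> u - l * (u \<bullet> u) / 2 - (fw - fx)))"
    using s l unfolding L power2_norm_eq_inner
    by (simp add: inner_commute inner_add_left inner_add_right inner_diff_left
        inner_diff_right field_simps power2_eq_square)
  also have "\<dots> \<ge> 0"
    using s l min cur by (intro mult_nonneg_nonneg add_nonneg_nonneg) auto
  finally show ?thesis
    by simp
qed

text \<open>Both \<open>w\<close> and \<open>y\<close> extrapolate along the same difference of
  iterates, and \<open>(s + 1) * theta = tau\<close> for \<open>s = sqrt (L / l)\<close>. At index 0
  both sides equal \<open>x0\<close>. This form makes \<open>y - m\<close> equal to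
  \<open>z + s u\<close>.\<close>

lemma ag_y_eq:
  assumes "accelerated_gradient f L l x0 x w" and "L / l > 0"
  shows "ag_y (L / l) x k = x k + (sqrt (L / l) + 1) *\<^sub>R (w k - x k)"
proof (cases k)
  case 0
  then show ?thesis
    using assms(1) by (simp add: accelerated_gradient_def)
next
  case (Suc j)
  have "sqrt (L / l) + 1 > 0"
    using assms(2) by (intro add_pos_pos real_sqrt_gt_zero) auto
  then have "(sqrt (L / l) + 1) * ag_theta (L / l) = ag_tau (L / l)"
    by (simp add: ag_theta_def ag_tau_def)
  then show ?thesis
    using assms(1) Suc by (simp add: accelerated_gradient_def)
qed

lemma potential_Suc_le:
  assumes f: "smooth_strongly_convex f L l" and ag: "accelerated_gradient f L l x0 x w"
    and IH: "(norm (ag_y (L / l) x k - m))\<^sup>2 + 2 * (f (x k) - f m) / l \<le> \<sigma>\<^sup>2"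
  shows "(norm (ag_y (L / l) x (Suc k) - m))\<^sup>2 + 2 * (f (x (Suc k)) - f m) / l
    \<le> sigma_radicand f L l x w k \<sigma>"
proof -
  define s where "s = sqrt (L / l)"
  define u where "u = w k - x k"
  define z where "z = w k - m"
  define g where "g = grad f (w k)"
  have l: "l > 0" and "L \<ge> l"
    using f by (auto simp: smooth_strongly_convex_def)
  then have s: "s \<ge> 1" and Ls: "L = s\<^sup>2 * l" and "L / l > 0"
    by (auto simp: s_def)
  have y: "ag_y (L / l) x k - m = z + s *\<^sub>R u"
    unfolding ag_y_eq[OF ag \<open>L / l > 0\<close>] by (simp add: s_def u_def z_def algebra_simps)
  have x': "x (Suc k) = w k - g /\<^sub>R L"
    using ag by (simp add: accelerated_gradient_def g_def)
  have "ag_y (L / l) x (Suc k) = x (Suc k) + (s - 1) *\<^sub>R (x (Suc k) - x k)"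
    by (simp add: ag_tau_def s_def)
  then have y': "ag_y (L / l) x (Suc k) - m = z + (s - 1) *\<^sub>R u - (s / L) *\<^sub>R g"
    unfolding x' by (simp add: u_def z_def algebra_simps divide_inverse)
  have "(norm (ag_y (L / l) x (Suc k) - m))\<^sup>2 + 2 * (f (x (Suc k)) - f m) / l
      \<le> (1 - 1 / s) * ((norm (z + s *\<^sub>R u))\<^sup>2 + 2 * (f (x k) - f m) / l)
        + 2 * (f (x (Suc k)) - f (w k)) / l + (norm g)\<^sup>2 / (L * l) - (s - 1 / s) * (norm u)\<^sup>2"
    unfolding y' using s l Ls
    by (rule potential_step)
      (use strong_convexity_ineq[OF f, of "w k"] in \<open>auto simp: g_def z_def u_def\<close>)
  \<comment> \<open>The factor \<open>1 - 1 / s\<close> is nonnegative, so the radicand is monotone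
    in the square of sigma.\<close>
  also have "\<dots> \<le> (1 - 1 / s) * \<sigma>\<^sup>2
        + 2 * (f (x (Suc k)) - f (w k)) / l + (norm g)\<^sup>2 / (L * l) - (s - 1 / s) * (norm u)\<^sup>2"
    using IH[unfolded y] s by (intro diff_right_mono add_right_mono mult_left_mono) auto
  also have "\<dots> = sigma_radicand f L l x w k \<sigma>"
    by (simp add: sigma_radicand_def Let_def s_def u_def g_def)
  finally show ?thesis .
qed

theorem theorem11:
  fixes f :: "real ^ 'n \<Rightarrow> real" and L l :: real
    and x0 xstar :: "real ^ 'n" and x w :: "nat \<Rightarrow> real ^ 'n"
  assumes "smooth_strongly_convex f L l"
    and "is_arg_min f (\<lambda>_. True) xstar"
    and "accelerated_gradient f L l x0 x w"
  shows "\<forall>k. 0 \<le> sigma_radicand f L l x w k (ag_sigma f L l x w k) \<and>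
             (norm (ag_y (L / l) x k - xstar))\<^sup>2 + 2 * (f (x k) - f xstar) / l
               \<le> (ag_sigma f L l x w k)\<^sup>2"
proof -
  let ?V = "\<lambda>k. (norm (ag_y (L / l) x k - xstar))\<^sup>2 + 2 * (f (x k) - f xstar) / l"
  let ?r = "\<lambda>k. sigma_radicand f L l x w k (ag_sigma f L l x w k)"
  have l: "l > 0"
    using assms(1) by (simp add: smooth_strongly_convex_def)
  have V_nonneg: "0 \<le> ?V k" for k
    using assms(2) l by (simp add: is_arg_min_linorder)
  have step: "?V (Suc k) \<le> ?r k" if "?V k \<le> (ag_sigma f L l x w k)\<^sup>2" for k
    using assms(1,3) that by (rule potential_Suc_le)
  have bound: "?V k \<le> (ag_sigma f L l x w k)\<^sup>2" for k
  proof (induction k)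
    case 0
    then show ?case
      using initial_potential_le[OF assms(1,2), of "x 0"] by simp
  next
    case (Suc k)
    \<comment> \<open>The radicand dominates a nonnegative potential, so squaring its
      \<open>sqrt\<close> returns the radicand itself and not merely its absolute value.\<close>
    have "0 \<le> ?r k"
      using V_nonneg[of "Suc k"] step[OF Suc.IH] by linarith
    then show ?case
      using step[OF Suc.IH] by simp
  qed
  have "0 \<le> ?r k" for k
    using V_nonneg[of "Suc k"] step[OF bound] by (rule order_trans)
  with bound show ?thesis
    by blast
qed

end
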